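(* There exists a single-pass streaming algorithm for $1$-VC-CAP in the link-arrival model, with link weights in $[1,W]$ arriving in an insertion-only stream, that uses $O(n\epsilon^{-1}\log W)$ space and outputs a $(3+\epsilon)$-approximate solution.
   Context: $1$-VC-CAP in the link-arrival model: a connected ($1$-vertex-connected) spanning graph $G=(V,E)$ on $n$ vertices is given up front (its storage does not count toward space). A set of links $L\subseteq V\times V$ with weights $w:L\to[1,W]$ arrives one by one in arbitrary order in a single pass. The goal is to output a minimum-weight subset $L'\subseteq L$ such that $(V,E\cup L')$ is $2$-vertex-connected. Space is measured in words; computation time is unrestricted (an exact optimal solution may be computed on the stored links at the end of the stream). $\epsilon>0$ is a parameter. *)

theory Defs
  imports Complex_Main
begin

text \<open>Edges of a graph are two-element vertex sets, links are ordered pairs as in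
  \<open>L \<subseteq> V \<times> V\<close>; a link joins its two endpoints irrespective of its orientation.\<close>

type_synonym 'v link = "'v \<times> 'v"

definition simple_graph :: "'v set \<Rightarrow> 'v set set \<Rightarrow> bool" where
  "simple_graph V E \<longleftrightarrow> finite V \<and> (\<forall>e\<in>E. e \<subseteq> V \<and> card e = 2)"

definition connected_graph :: "'v set \<Rightarrow> 'v set set \<Rightarrow> bool" where
  "connected_graph V E \<longleftrightarrow> V \<noteq> {} \<and>
     (\<forall>u\<in>V. \<forall>v\<in>V. (u, v) \<in> {(x, y). x \<in> V \<and> y \<in> V \<and> {x, y} \<in> E}\<^sup>*)"

text \<open>\<open>connected_graph\<close> ignores all edges that leave its vertex set, so
  \<open>connected_graph (V - S) E\<close> speaks about the graph with the vertices \<open>S\<close> deleted.\<close>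

definition vertex_connected :: "nat \<Rightarrow> 'v set \<Rightarrow> 'v set set \<Rightarrow> bool" where
  "vertex_connected k V E \<longleftrightarrow> card V > k \<and>
     (\<forall>S \<subseteq> V. card S < k \<longrightarrow> connected_graph (V - S) E)"

definition link_edges :: "'v link set \<Rightarrow> 'v set set" where
  "link_edges L = (\<lambda>(u, v). {u, v}) ` L"

definition vc_cap_solutions ::
    "'v set \<Rightarrow> 'v set set \<Rightarrow> 'v link set \<Rightarrow> 'v link set set" where
  "vc_cap_solutions V E L = {L'. L' \<subseteq> L \<and> vertex_connected 2 V (E \<union> link_edges L')}"

definition vc_cap_opt ::
    "'v set \<Rightarrow> 'v set set \<Rightarrow> 'v link set \<Rightarrow> ('v link \<Rightarrow> real) \<Rightarrow> real" where
  "vc_cap_opt V E L w = Min (sum w ` vc_cap_solutions V E L)"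

definition vc_cap_approx ::
    "real \<Rightarrow> 'v set \<Rightarrow> 'v set set \<Rightarrow> 'v link set \<Rightarrow> ('v link \<Rightarrow> real) \<Rightarrow> 'v link set \<Rightarrow> bool"
  where
  "vc_cap_approx \<alpha> V E L w L' \<longleftrightarrow>
     L' \<in> vc_cap_solutions V E L \<and> sum w L' \<le> \<alpha> * vc_cap_opt V E L w"

text \<open>The memory of a streaming algorithm is a list of machine words. The three components
  are arbitrary functions, since computation time is unrestricted; everything that is
  carried over from one stream item to the next, or to the final output, has to pass through
  the memory.\<close>

record ('item, 'out) streaming_algorithm =
  init_mem :: "nat list"
  process :: "'item \<Rightarrow> nat list \<Rightarrow> nat list"
  answer :: "nat list \<Rightarrow> 'out"

definition memory_after :: "('item, 'out) streaming_algorithm \<Rightarrow> 'item list \<Rightarrow> nat list" where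
  "memory_after A xs = fold (process A) xs (init_mem A)"

definition stream_result :: "('item, 'out) streaming_algorithm \<Rightarrow> 'item list \<Rightarrow> 'out" where
  "stream_result A xs = answer A (memory_after A xs)"

text \<open>At every point of the stream at most \<open>s\<close> words of \<open>b\<close> bits each are in use.\<close>

definition runs_in_space ::
    "('item, 'out) streaming_algorithm \<Rightarrow> nat \<Rightarrow> real \<Rightarrow> 'item list \<Rightarrow> bool" where
  "runs_in_space A b s xs \<longleftrightarrow>
     (\<forall>k \<le> length xs.
        real (length (memory_after A (take k xs))) \<le> s \<and>
        (\<forall>x \<in> set (memory_after A (take k xs)). x < 2 ^ b))"

definition arrival_order :: "'a set \<Rightarrow> 'a list \<Rightarrow> bool" where
  "arrival_order L xs \<longleftrightarrow> distinct xs \<and> set xs = L"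

definition weighted_stream :: "('a \<Rightarrow> real) \<Rightarrow> 'a list \<Rightarrow> ('a \<times> real) list" where
  "weighted_stream w xs = map (\<lambda>e. (e, w e)) xs"

text \<open>Words of \<open>O(log n)\<close> bits; \<open>n + 1\<close> instead of \<open>n\<close> only matters for \<open>n = 1\<close>.\<close>

definition word_bits :: "nat \<Rightarrow> nat \<Rightarrow> nat" where
  "word_bits c n = c * nat \<lceil>log 2 (real n + 1)\<rceil>"

text \<open>For \<open>\<epsilon> \<le> 1\<close> and \<open>W \<ge> 2\<close> this is literally \<open>n * (1/\<epsilon>) * log W\<close>. Outside this range
  that product can be arbitrarily close to \<open>0\<close> (and is \<open>0\<close> for \<open>W = 1\<close>), so that it cannot
  bound the space of any algorithm; the usual convention is to read the factors \<open>1/\<epsilon>\<close> and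
  \<open>log W\<close> as at least \<open>1\<close>.\<close>

definition space_bound :: "nat \<Rightarrow> real \<Rightarrow> real \<Rightarrow> real" where
  "space_bound n W \<epsilon> = real n * max 1 (1 / \<epsilon>) * max 1 (log 2 W)"

end

theory Submission
  imports Defs
begin

text \<open>Fix a root \<open>r\<close>. Deleting a vertex \<open>x\<close> separates \<open>G\<close> into the component of \<open>r\<close>
  (\<open>root_side x\<close>) and the components that \<open>x\<close> cuts off from \<open>r\<close> (\<open>below x\<close>). The vertices \<open>x\<close>
  with \<open>u \<in> below x\<close> form a chain, and those at which a link \<open>uv\<close> reconnects \<open>u\<close> with \<open>r\<close> form an
  initial segment of it. Hence for each \<open>u\<close> a single link reaching furthest up is at least as good
  as every other link at \<open>u\<close>. Besides, a link \<open>uv\<close> joins two different components of \<open>below x\<close> for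
  at most one \<open>x\<close>. Each of these components contains a neighbour of \<open>x\<close> that determines \<open>x\<close>, so
  that \<open>n\<close> links suffice to join, for every \<open>x\<close>, those components of \<open>below x\<close> that are joined by
  all links inside \<open>below x\<close>.

  Round the weights down to powers of \<open>1 + \<delta>\<close>. For each weight class, store for every vertex its
  furthest reaching link, and the \<open>n\<close> joining links. Given an optimal solution, replace a link \<open>uv\<close> by
  the furthest reaching links of its class at \<open>u\<close> and at \<open>v\<close>, and, for the only \<open>x\<close> at which it
  joins two components of \<open>below x\<close>, by one further stored link of its class, found by an exchange
  argument as for minimum spanning trees. This costs at most three times as much as the optimum.\<close>

lemma sum_Un_le:
  fixes f :: "'a \<Rightarrow> 'b::ordered_comm_monoid_add"
  assumes "\<And>x. 0 \<le> f x"
  shows "sum f (A \<union> B) \<le> sum f A + sum f B"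
proof (cases "finite (A \<union> B)")
  case True
  then have "sum f (A \<union> B) = sum f A + sum f (B - A)"
    using sum.union_disjoint[of A "B - A" f] by auto
  also have "\<dots> \<le> sum f A + sum f B"
    using True assms by (intro add_left_mono sum_mono2) auto
  finally show ?thesis .
next
  case False
  then show ?thesis using assms by (simp add: sum_nonneg)
qed

lemma sum_UN_le:
  fixes f :: "'a \<Rightarrow> 'b::ordered_comm_monoid_add"
  assumes "finite I" "\<And>x. 0 \<le> f x"
  shows "sum f (\<Union>i\<in>I. B i) \<le> (\<Sum>i\<in>I. sum f (B i))"
  using assms(1)
proof (induction I rule: finite_induct)
  case (insert i I)
  have "sum f (B i \<union> (\<Union>i\<in>I. B i)) \<le> sum f (B i) + sum f (\<Union>i\<in>I. B i)"
    by (rule sum_Un_le) (rule assms(2))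
  also have "\<dots> \<le> sum f (B i) + (\<Sum>i\<in>I. sum f (B i))"
    by (intro add_left_mono insert.IH)
  finally show ?case using insert.hyps by simp
qed simp

section \<open>Reachability and exchange of links\<close>

lemma rtrancl_crossing:
  assumes "(a, b) \<in> R\<^sup>*" "a \<in> A" "b \<notin> A"
  obtains s t where "(s, t) \<in> R" "s \<in> A" "t \<notin> A"
  using assms by (induction rule: rtrancl_induct) auto

definition adj :: "'v set \<Rightarrow> 'v set set \<Rightarrow> ('v \<times> 'v) set" where
  "adj V E = {(x, y). x \<in> V \<and> y \<in> V \<and> {x, y} \<in> E}"

abbreviation reach :: "'v set \<Rightarrow> 'v set set \<Rightarrow> ('v \<times> 'v) set" where
  "reach V E \<equiv> (adj V E)\<^sup>*"

abbreviation link_reach :: "'v set \<Rightarrow> 'v set set \<Rightarrow> 'v link set \<Rightarrow> ('v \<times> 'v) set" where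
  "link_reach V E F \<equiv> reach V (E \<union> link_edges F)"

lemma connected_graph_iff_reach: "connected_graph V E \<longleftrightarrow> V \<noteq> {} \<and> V \<times> V \<subseteq> reach V E"
  by (auto simp: connected_graph_def adj_def)

lemma reach_sym: "(x, y) \<in> reach V E \<Longrightarrow> (y, x) \<in> reach V E"
proof -
  have "sym (adj V E)" by (auto simp: sym_def adj_def insert_commute)
  then show "(x, y) \<in> reach V E \<Longrightarrow> (y, x) \<in> reach V E"
    by (meson sym_rtrancl symD)
qed

lemma reach_mono: "V \<subseteq> V' \<Longrightarrow> E \<subseteq> E' \<Longrightarrow> reach V E \<subseteq> reach V' E'"
  by (rule rtrancl_mono) (auto simp: adj_def)

lemma link_reach_mono: "F \<subseteq> F' \<Longrightarrow> link_reach V E F \<subseteq> link_reach V E F'"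
  by (intro reach_mono) (auto simp: link_edges_def)

lemma reach_subset_link_reach: "reach V E \<subseteq> link_reach V E F"
  by (intro reach_mono) auto

lemma adj_link_edges_cases:
  assumes "(a, b) \<in> adj V (E \<union> link_edges F)"
  obtains "(a, b) \<in> adj V E" | "(a, b) \<in> F \<inter> V \<times> V" | "(b, a) \<in> F \<inter> V \<times> V"
  using assms by (auto simp: adj_def link_edges_def doubleton_eq_iff)

lemma links_subset_link_reach: "F \<inter> V \<times> V \<subseteq> link_reach V E F"
  by (force simp: adj_def link_edges_def)

lemma link_reach_subset_iff:
  "link_reach V E F \<subseteq> link_reach V E F' \<longleftrightarrow> F \<inter> V \<times> V \<subseteq> link_reach V E F'"
proof
  assume F: "F \<inter> V \<times> V \<subseteq> link_reach V E F'"
  show "link_reach V E F \<subseteq> link_reach V E F'"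
  proof (rule rtrancl_subset_rtrancl, rule subrelI)
    fix a b assume "(a, b) \<in> adj V (E \<union> link_edges F)"
    then show "(a, b) \<in> link_reach V E F'"
    proof (cases rule: adj_link_edges_cases)
      case 1
      then show ?thesis using reach_subset_link_reach by blast
    next
      case 2
      then show ?thesis using F by blast
    next
      case 3
      then show ?thesis using F by (intro reach_sym[of b a]) blast
    qed
  qed
qed (use links_subset_link_reach in blast)

lemma link_reach_insert_cases:
  assumes "(y, z) \<in> link_reach V E (insert (a, b) M)"
  obtains "(y, z) \<in> link_reach V E M"
  | "(y, a) \<in> link_reach V E M" "(b, z) \<in> link_reach V E M"
  | "(y, b) \<in> link_reach V E M" "(a, z) \<in> link_reach V E M"
proof -
  let ?R = "link_reach V E M"
  have "(y, z) \<in> ?R \<or> (y, a) \<in> ?R \<and> (b, z) \<in> ?R \<or> (y, b) \<in> ?R \<and> (a, z) \<in> ?R"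
    using assms
  proof (induction rule: rtrancl_induct)
    case (step s t)
    have "(s, t) \<in> adj V (E \<union> link_edges M) \<or> (s, t) = (a, b) \<or> (s, t) = (b, a)"
      using step.hyps(2) by (auto simp: adj_def link_edges_def doubleton_eq_iff)
    then show ?case
      using step.IH by (elim disjE) (auto intro: rtrancl_into_rtrancl)
  qed simp
  then show thesis using that by blast
qed

lemma link_leaving_component:
  assumes "(a, b) \<in> link_reach V E N" "(a, b) \<notin> link_reach V E M"
  obtains s t f where "f \<in> N \<inter> V \<times> V" "f = (s, t) \<or> f = (t, s)"
    and "(a, s) \<in> link_reach V E M" "(a, t) \<notin> link_reach V E M"
proof -
  obtain s t where st: "(s, t) \<in> adj V (E \<union> link_edges N)"
    "(a, s) \<in> link_reach V E M" "(a, t) \<notin> link_reach V E M"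
    using rtrancl_crossing[OF assms(1), of "{z. (a, z) \<in> link_reach V E M}"] assms(2) by auto
  show thesis
    using st(1)
  proof (cases rule: adj_link_edges_cases)
    case 1
    then have "(s, t) \<in> link_reach V E M" using reach_subset_link_reach by blast
    then show ?thesis using st(2,3) by (meson rtrancl_trans)
  qed (use that st(2,3) in blast)+
qed

lemma connecting_link_exchange:
  assumes conn: "connected_graph V (E \<union> link_edges (insert (a, b) M))"
    and ab: "(a, b) \<in> link_reach V E N" "a \<in> V"
  obtains B where "B \<subseteq> N" "finite B" "card B \<le> 1"
    "connected_graph V (E \<union> link_edges (B \<union> M))"
proof -
  let ?R = "link_reach V E"
  have connI: "connected_graph V (E \<union> link_edges F)" if "M \<subseteq> F" "(a, b) \<in> ?R F" for F
  proof -
    have "insert (a, b) M \<inter> V \<times> V \<subseteq> ?R F"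
      using that links_subset_link_reach[of F V E] by blast
    then have "?R (insert (a, b) M) \<subseteq> ?R F" by (simp only: link_reach_subset_iff)
    then show ?thesis using conn unfolding connected_graph_iff_reach by blast
  qed
  show thesis
  proof (cases "(a, b) \<in> ?R M")
    case True
    then show ?thesis using that[of "{}"] connI[of M] by simp
  next
    case False
    obtain s t f where f: "f \<in> N \<inter> V \<times> V" "f = (s, t) \<or> f = (t, s)"
      and st: "(a, s) \<in> ?R M" "(a, t) \<notin> ?R M"
      using link_leaving_component[OF ab(1) False] by blast
    have "(a, t) \<in> ?R (insert (a, b) M)"
      using conn ab(2) f unfolding connected_graph_iff_reach by auto
    then have "(b, t) \<in> ?R M"
      using st(2) by (cases rule: link_reach_insert_cases) auto
    then have "(a, s) \<in> ?R (insert f M)" "(t, b) \<in> ?R (insert f M)"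
      using st(1) link_reach_mono[of M "insert f M" V E] by (auto intro: reach_sym)
    moreover have "f \<in> ?R (insert f M)"
      using f(1) links_subset_link_reach[of "insert f M" V E] by blast
    then have "(s, t) \<in> ?R (insert f M)" using f(2) by (auto intro: reach_sym)
    ultimately have "(a, b) \<in> ?R (insert f M)" by (meson rtrancl_trans)
    then have "connected_graph V (E \<union> link_edges ({f} \<union> M))" using connI[of "insert f M"] by auto
    then show ?thesis using that[of "{f}"] f(1) by simp
  qed
qed

lemma connecting_links_exchange:
  fixes w :: "'v link \<Rightarrow> real"
  assumes nonneg: "\<And>e. 0 \<le> w e"
    and "finite X" "X \<subseteq> V \<times> V" "\<And>e. e \<in> X \<Longrightarrow> e \<in> link_reach V E {f \<in> F. w f \<le> w e}"
    and "connected_graph V (E \<union> link_edges (M \<union> X))"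
  shows "\<exists>B\<subseteq>F. finite B \<and> sum w B \<le> sum w X \<and> connected_graph V (E \<union> link_edges (M \<union> B))"
  using assms(2-)
proof (induction X arbitrary: M rule: finite_induct)
  case empty
  then show ?case by (intro exI[of _ "{}"]) auto
next
  case (insert e X)
  obtain a b where e: "e = (a, b)" by fastforce
  obtain B\<^sub>e where B\<^sub>e: "B\<^sub>e \<subseteq> {f \<in> F. w f \<le> w e}" "finite B\<^sub>e" "card B\<^sub>e \<le> 1"
    "connected_graph V (E \<union> link_edges (B\<^sub>e \<union> (M \<union> X)))"
    using connecting_link_exchange[of V E a b "M \<union> X" "{f \<in> F. w f \<le> w e}"] insert.prems e by auto
  then obtain B where B: "B \<subseteq> F" "finite B" "sum w B \<le> sum w X"
    "connected_graph V (E \<union> link_edges ((B\<^sub>e \<union> M) \<union> B))"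
    using insert.IH[of "B\<^sub>e \<union> M"] insert.prems(1,2) by (auto simp: Un_assoc)
  have "sum w B\<^sub>e \<le> real (card B\<^sub>e) * w e"
    using B\<^sub>e(1) by (intro sum_bounded_above) auto
  also have "\<dots> \<le> w e" using B\<^sub>e(3) nonneg[of e] by (simp add: mult_left_le_one_le)
  finally have "sum w (B\<^sub>e \<union> B) \<le> sum w (insert e X)"
    using sum_Un_le[of w B\<^sub>e B] nonneg B(3) insert.hyps by force
  moreover have "M \<union> (B\<^sub>e \<union> B) = (B\<^sub>e \<union> M) \<union> B" by blast
  ultimately show ?case using B B\<^sub>e(1,2) by (intro exI[of _ "B\<^sub>e \<union> B"]) auto
qed

definition components_meeting :: "'v set \<Rightarrow> 'v set set \<Rightarrow> 'v set \<Rightarrow> 'v set set" where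
  "components_meeting V E H = (\<lambda>h. reach V E `` {h}) ` H"

lemma card_components_meeting_insert_less:
  assumes "finite H" "a \<in> V" "b \<in> V" "(a, b) \<notin> link_reach V E F"
    and "h\<^sub>a \<in> H" "(a, h\<^sub>a) \<in> reach V E" "h\<^sub>b \<in> H" "(b, h\<^sub>b) \<in> reach V E"
  shows "card (components_meeting V (E \<union> link_edges (insert (a, b) F)) H)
    < card (components_meeting V (E \<union> link_edges F) H)"
proof -
  let ?R = "link_reach V E F" and ?R' = "link_reach V E (insert (a, b) F)"
  let ?C = "components_meeting V (E \<union> link_edges F) H"
  have sub: "?R \<subseteq> ?R'" by (intro link_reach_mono) auto
  then have image: "?R' `` (?R `` {h}) = ?R' `` {h}" for h
    by (auto intro: rtrancl_trans)
  have "components_meeting V (E \<union> link_edges (insert (a, b) F)) H = (\<lambda>C. ?R' `` C) ` ?C"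
    by (simp only: components_meeting_def image_image image)
  moreover have "\<not> inj_on (\<lambda>C. ?R' `` C) ?C"
  proof
    assume inj: "inj_on (\<lambda>C. ?R' `` C) ?C"
    have ah: "(a, h\<^sub>a) \<in> ?R" "(b, h\<^sub>b) \<in> ?R"
      using assms(6,8) reach_subset_link_reach[of V E F] by blast+
    have "(a, b) \<in> ?R'" using assms(2,3) links_subset_link_reach[of "insert (a, b) F" V E] by blast
    then have "(h\<^sub>a, h\<^sub>b) \<in> ?R'" using ah sub by (meson reach_sym rtrancl_trans subsetD)
    then have "?R' `` {h\<^sub>a} = ?R' `` {h\<^sub>b}" using reach_sym by (fastforce intro: rtrancl_trans)
    then have "?R `` {h\<^sub>a} = ?R `` {h\<^sub>b}"
      using inj_onD[OF inj, of "?R `` {h\<^sub>a}" "?R `` {h\<^sub>b}"] image assms(5,7)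
      by (auto simp: components_meeting_def)
    then have "(h\<^sub>a, h\<^sub>b) \<in> ?R" by blast
    then show False using ah assms(4) by (meson reach_sym rtrancl_trans)
  qed
  moreover have "finite ?C" using assms(1) by (simp add: components_meeting_def)
  ultimately show ?thesis
    by (metis card_image_le eq_card_imp_inj_on order_le_neq_trans)
qed

lemma sparse_spanning_links:
  assumes "finite X" "X \<subseteq> S \<times> S" "S \<subseteq> V"
    and "finite H" "\<And>v. v \<in> S \<Longrightarrow> \<exists>h\<in>H. (v, h) \<in> reach V E"
  shows "\<exists>F\<subseteq>X. card F \<le> card H \<and> X \<subseteq> link_reach V E F"
proof -
  let ?c = "\<lambda>F. card (components_meeting V (E \<union> link_edges F) H)"
  have "\<exists>F\<subseteq>X. card F + ?c F \<le> ?c {} \<and> X \<subseteq> link_reach V E F"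
    using assms(1,2)
  proof (induction X rule: finite_induct)
    case (insert e X)
    obtain F where F: "F \<subseteq> X" "card F + ?c F \<le> ?c {}" "X \<subseteq> link_reach V E F"
      using insert.IH insert.prems by blast
    obtain a b where e: "e = (a, b)" "a \<in> S" "b \<in> S" using insert.prems by blast
    show ?case
    proof (cases "e \<in> link_reach V E F")
      case True
      then show ?thesis using F by blast
    next
      case False
      obtain h\<^sub>a h\<^sub>b where "h\<^sub>a \<in> H" "(a, h\<^sub>a) \<in> reach V E" "h\<^sub>b \<in> H" "(b, h\<^sub>b) \<in> reach V E"
        using assms(5) e by meson
      then have "?c (insert e F) < ?c F"
        using card_components_meeting_insert_less[OF assms(4)] False e assms(3) by blast
      moreover have "card (insert e F) \<le> Suc (card F)" by (rule card_insert_le_m1) auto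
      moreover have "insert e X \<subseteq> link_reach V E (insert e F)"
        using F(3) link_reach_mono[of F "insert e F" V E]
          links_subset_link_reach[of "insert e F" V E] e assms(3) by blast
      ultimately show ?thesis using F(1,2) by (intro exI[of _ "insert e F"]) auto
    qed
  qed auto
  moreover have "?c {} \<le> card H"
    unfolding components_meeting_def by (rule card_image_le) (rule assms(4))
  ultimately show ?thesis by (meson add_leD1 order_trans)
qed

lemma vertex_connected_2_iff:
  "vertex_connected 2 V E \<longleftrightarrow> 2 < card V \<and> (\<forall>x\<in>V. connected_graph (V - {x}) E)"
proof (intro iffI conjI ballI)
  fix x assume "vertex_connected 2 V E" "x \<in> V"
  then show "connected_graph (V - {x}) E" by (simp add: vertex_connected_def)
next
  assume R: "2 < card V \<and> (\<forall>x\<in>V. connected_graph (V - {x}) E)"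
  then have fin: "finite V" by (metis card.infinite not_less_zero)
  have "(u, v) \<in> reach V E" if "u \<in> V" "v \<in> V" for u v
  proof -
    have "card {u, v} < card V" using R card_2_iff[of "{u, v}"] by (cases "u = v") auto
    then obtain x where "x \<in> V" "x \<notin> {u, v}"
      using fin card_mono[of "{u, v}" V] by fastforce
    then have "(V - {x}) \<times> (V - {x}) \<subseteq> reach (V - {x}) E" "x \<noteq> u" "x \<noteq> v"
      using R unfolding connected_graph_iff_reach by blast+
    then have "(u, v) \<in> reach (V - {x}) E" using that by blast
    then show ?thesis using reach_mono[of "V - {x}" V E E] by blast
  qed
  then have whole: "connected_graph V E" using R by (auto simp: connected_graph_iff_reach)
  have "connected_graph (V - D) E" if D: "D \<subseteq> V" "card D < 2" for D
  proof -
    have "finite D" using D fin finite_subset by blast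
    then consider "D = {}" | x where "D = {x}"
      using D(2) by (metis card_0_eq card_1_singletonE less_2_cases One_nat_def)
    then show ?thesis using whole R D(1) by cases auto
  qed
  then show "vertex_connected 2 V E" using R by (simp add: vertex_connected_def)
qed (simp add: vertex_connected_def)

section \<open>Cut vertices seen from a root\<close>

definition incident :: "'v \<Rightarrow> 'v link \<Rightarrow> bool" where
  "incident u e \<longleftrightarrow> u = fst e \<or> u = snd e"

locale rooted_graph =
  fixes V :: "'v set" and E :: "'v set set" and r :: 'v
  assumes finite_V: "finite V" and root: "r \<in> V" and connected: "V \<times> V \<subseteq> reach V E"
begin

definition root_side :: "'v \<Rightarrow> 'v set" where
  "root_side x = {y \<in> V - {x}. (r, y) \<in> reach (V - {x}) E}"

definition below :: "'v \<Rightarrow> 'v set" where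
  "below x = V - {x} - root_side x"

abbreviation reach_without :: "'v \<Rightarrow> 'v link set \<Rightarrow> ('v \<times> 'v) set" where
  "reach_without x F \<equiv> link_reach (V - {x}) E F"

lemma root_sideD: "y \<in> root_side x \<Longrightarrow> y \<in> V \<and> y \<noteq> x \<and> y \<notin> below x"
  by (auto simp: root_side_def below_def)

lemma belowD: "y \<in> below x \<Longrightarrow> y \<in> V \<and> y \<noteq> x \<and> y \<notin> root_side x"
  by (auto simp: below_def)

lemma not_below_self: "x \<notin> below x"
  by (simp add: below_def)

lemma root_side_or_below: "y \<in> V \<Longrightarrow> y \<noteq> x \<Longrightarrow> y \<in> root_side x \<or> y \<in> below x"
  by (auto simp: below_def)

lemma root_in_root_side: "x \<noteq> r \<Longrightarrow> r \<in> root_side x"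
  using root by (auto simp: root_side_def)

lemma root_side_root: "root_side r = {}"
proof -
  have "y = r" if "(r, y) \<in> reach (V - {r}) E" for y
    using that by (induction rule: rtrancl_induct) (auto simp: adj_def)
  then show ?thesis by (auto simp: root_side_def)
qed

lemma root_side_reach: "root_side x \<times> root_side x \<subseteq> reach (V - {x}) E"
  by (auto simp: root_side_def intro: rtrancl_trans[OF reach_sym])

lemma adj_without: "(s, t) \<in> adj V E \<Longrightarrow> s \<noteq> x \<Longrightarrow> t \<noteq> x \<Longrightarrow> (s, t) \<in> adj (V - {x}) E"
  by (simp add: adj_def)

lemma root_side_adj:
  assumes "s \<in> root_side x" "(s, t) \<in> adj V E" "t \<noteq> x"
  shows "t \<in> root_side x"
proof -
  have "(s, t) \<in> adj (V - {x}) E" using assms root_sideD by (intro adj_without) auto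
  then show ?thesis using assms(1) by (auto simp: root_side_def adj_def intro: rtrancl_into_rtrancl)
qed

lemma below_adj:
  assumes "s \<in> below x" "(s, t) \<in> adj V E" "t \<noteq> x"
  shows "t \<in> below x"
proof (rule ccontr)
  assume "t \<notin> below x"
  then have "t \<in> root_side x" using assms root_side_or_below by (auto simp: adj_def)
  moreover have "(t, s) \<in> adj V E" using assms(2) by (simp add: adj_def insert_commute)
  ultimately show False using root_side_adj assms(1) belowD by blast
qed

lemma reach_avoiding_one_of_two:
  assumes "a \<in> V" "x \<in> V" "a \<noteq> x" "a \<noteq> y" "x \<noteq> y"
  shows "(a, x) \<in> reach (V - {y}) E \<or> (a, y) \<in> reach (V - {x}) E"
proof -
  let ?A = "{z \<in> V - {x, y}. (a, z) \<in> reach (V - {x}) E \<and> (a, z) \<in> reach (V - {y}) E}"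
  have "(a, x) \<in> reach V E" using connected assms by blast
  then obtain s t where st: "(s, t) \<in> adj V E" "s \<in> ?A" "t \<notin> ?A"
    using rtrancl_crossing[of a x "adj V E" ?A] assms by auto
  have x_step: "(a, t) \<in> reach (V - {x}) E" if "t \<noteq> x"
    using adj_without[OF st(1)] that st(2) by (auto intro: rtrancl_into_rtrancl)
  have y_step: "(a, t) \<in> reach (V - {y}) E" if "t \<noteq> y"
    using adj_without[OF st(1)] that st(2) by (auto intro: rtrancl_into_rtrancl)
  have "t = x \<or> t = y" using x_step y_step st(1,3) by (auto simp: adj_def)
  then show ?thesis using x_step y_step assms(5) by blast
qed

lemma below_closed: "(u, v) \<in> reach (V - {x}) E \<Longrightarrow> u \<in> below x \<Longrightarrow> v \<in> below x"
  by (induction rule: rtrancl_induct) (auto simp: adj_def intro: below_adj)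

lemma below_imp_root_side:
  assumes "x \<in> below y" "y \<in> V"
  shows "y \<in> root_side x"
proof (cases "y = r")
  case True
  then show ?thesis using assms belowD root_in_root_side by blast
next
  case False
  then have "x \<noteq> r" using assms root_in_root_side belowD by blast
  then show ?thesis
    using reach_avoiding_one_of_two[of r x y] assms root False belowD[OF assms(1)]
    by (auto simp: root_side_def)
qed

lemma below_chain:
  assumes "u \<in> below x" "u \<in> below y" "x \<in> V" "x \<noteq> y"
  shows "x \<in> below y \<or> y \<in> below x"
  using reach_avoiding_one_of_two[of u x y] below_closed assms belowD by blast

lemma root_side_antimono:
  assumes "x \<in> below y"
  shows "root_side y \<subseteq> root_side x"
proof
  fix v assume v: "v \<in> root_side y"
  then have "y \<noteq> r" using root_side_root by auto
  then have "r \<in> root_side y" using root_in_root_side by blast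
  moreover from this have "r \<in> root_side x"
    using assms belowD by (intro root_in_root_side) blast
  ultimately have r: "r \<in> root_side x \<inter> root_side y" by blast
  show "v \<in> root_side x"
  proof (rule ccontr)
    assume "v \<notin> root_side x"
    moreover have "(r, v) \<in> reach (V - {y}) E" using v by (simp add: root_side_def)
    ultimately obtain s t where st: "(s, t) \<in> adj (V - {y}) E"
      "s \<in> root_side x \<inter> root_side y" "t \<notin> root_side x \<inter> root_side y"
      using rtrancl_crossing[OF _ r] by blast
    then have adj: "(s, t) \<in> adj V E" "t \<noteq> y" by (auto simp: adj_def)
    then have "t \<in> root_side y" using root_side_adj st(2) by blast
    moreover have "t \<noteq> x" using calculation assms belowD by blast
    ultimately show False using root_side_adj adj st by blast
  qed
qed

lemma below_reach_nested:
  assumes "u \<in> below x" "x \<in> below y" "y \<in> V"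
  shows "(u, x) \<in> reach (V - {y}) E"
proof -
  let ?A = "{z \<in> below x. (u, z) \<in> reach (V - {y}) E}"
  have y: "y \<notin> below x" using below_imp_root_side assms(2,3) belowD by blast
  have "(u, x) \<in> reach V E" using connected assms belowD by blast
  then obtain s t where st: "(s, t) \<in> adj V E" "s \<in> ?A" "t \<notin> ?A"
    using rtrancl_crossing[of u x "adj V E" ?A] assms(1) not_below_self by auto
  have "t \<noteq> y" using st y below_adj assms(2) belowD by blast
  moreover have "s \<noteq> y" using st(2) y by blast
  ultimately have "(s, t) \<in> adj (V - {y}) E" using adj_without st(1) by blast
  then have "(u, t) \<in> reach (V - {y}) E" using st(2) by (auto intro: rtrancl_into_rtrancl)
  then show ?thesis using st below_adj by blast
qed

lemma below_separated_unique:
  assumes "u \<in> below x" "v \<in> below x" "u \<in> below y" "v \<in> below y" "x \<in> V" "y \<in> V"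
    and "(u, v) \<notin> reach (V - {x}) E" "(u, v) \<notin> reach (V - {y}) E"
  shows "x = y"
proof (rule ccontr)
  assume "x \<noteq> y"
  then have "x \<in> below y \<or> y \<in> below x" using below_chain assms by blast
  then show False
    using below_reach_nested assms by (meson reach_sym rtrancl_trans)
qed

definition neighbours_below :: "'v \<Rightarrow> 'v set" where
  "neighbours_below x = {h \<in> below x. {x, h} \<in> E}"

lemma below_reaches_neighbour:
  assumes "u \<in> below x" "x \<in> V"
  shows "\<exists>h\<in>neighbours_below x. (u, h) \<in> reach (V - {x}) E"
proof -
  let ?A = "{z \<in> below x. (u, z) \<in> reach (V - {x}) E}"
  have "(u, x) \<in> reach V E" using assms connected belowD by blast
  then obtain s t where st: "(s, t) \<in> adj V E" "s \<in> ?A" "t \<notin> ?A"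
    using rtrancl_crossing[of u x "adj V E" ?A] assms(1) not_below_self by auto
  have "t = x"
  proof (rule ccontr)
    assume "t \<noteq> x"
    then have "(u, t) \<in> reach (V - {x}) E"
      using adj_without[OF st(1)] st(2) belowD by (auto intro: rtrancl_into_rtrancl)
    then show False using st below_adj \<open>t \<noteq> x\<close> by blast
  qed
  then show ?thesis using st by (auto simp: adj_def neighbours_below_def insert_commute)
qed

lemma neighbours_below_disjoint:
  assumes "x \<in> V" "y \<in> V" "x \<noteq> y"
  shows "neighbours_below x \<inter> neighbours_below y = {}"
proof -
  have False if "h \<in> neighbours_below x" "h \<in> neighbours_below y" "x \<in> below y" "y \<in> V" for h x y
  proof -
    have "y \<in> root_side x" using below_imp_root_side that by blast
    moreover have "(y, h) \<in> adj V E" "h \<in> below x"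
      using that belowD by (auto simp: adj_def neighbours_below_def)
    ultimately show False using root_side_adj belowD by blast
  qed
  then show ?thesis using below_chain assms by (fastforce simp: neighbours_below_def)
qed

lemma sum_card_neighbours_below_le: "(\<Sum>x\<in>V. card (neighbours_below x)) \<le> card V"
proof -
  have sub: "neighbours_below x \<subseteq> V" for x using belowD by (auto simp: neighbours_below_def)
  then have "finite (neighbours_below x)" for x using finite_V finite_subset by blast
  then have "(\<Sum>x\<in>V. card (neighbours_below x)) = card (\<Union>x\<in>V. neighbours_below x)"
    using finite_V neighbours_below_disjoint by (intro card_UN_disjoint[symmetric]) auto
  also have "\<dots> \<le> card V" using sub finite_V by (intro card_mono) auto
  finally show ?thesis .
qed

lemma sparse_links_below:
  assumes "finite X"
  shows "\<exists>F\<subseteq>X. card F \<le> card V \<and> (\<forall>x\<in>V. X \<inter> below x \<times> below x \<subseteq> reach_without x F)"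
proof -
  have "\<exists>F\<subseteq>X \<inter> below x \<times> below x. card F \<le> card (neighbours_below x) \<and>
      X \<inter> below x \<times> below x \<subseteq> reach_without x F" if "x \<in> V" for x
  proof (rule sparse_spanning_links[where S = "below x"])
    show "finite (neighbours_below x)"
      using finite_V belowD by (auto simp: neighbours_below_def intro: finite_subset[of _ V])
    show "\<exists>h\<in>neighbours_below x. (v, h) \<in> reach (V - {x}) E" if "v \<in> below x" for v
      using below_reaches_neighbour that \<open>x \<in> V\<close> .
  qed (use assms belowD in auto)
  then obtain F where F: "\<And>x. x \<in> V \<Longrightarrow> F x \<subseteq> X \<and> card (F x) \<le> card (neighbours_below x) \<and>
      X \<inter> below x \<times> below x \<subseteq> reach_without x (F x)"
    by (metis le_infE)
  have "card (\<Union>x\<in>V. F x) \<le> (\<Sum>x\<in>V. card (F x))" by (rule card_UN_le) (rule finite_V)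
  also have "\<dots> \<le> (\<Sum>x\<in>V. card (neighbours_below x))" using F by (intro sum_mono) blast
  also have "\<dots> \<le> card V" by (rule sum_card_neighbours_below_le)
  finally have "card (\<Union>x\<in>V. F x) \<le> card V" .
  moreover have "X \<inter> below x \<times> below x \<subseteq> reach_without x (\<Union>x\<in>V. F x)" if "x \<in> V" for x
    using F[OF that] link_reach_mono[of "F x" "\<Union>x\<in>V. F x" "V - {x}" E] that by blast
  ultimately show ?thesis using F by (intro exI[of _ "\<Union>x\<in>V. F x"]) blast
qed

section \<open>Links representing other links\<close>

definition bypassed :: "'v \<Rightarrow> 'v link \<Rightarrow> 'v set" where
  "bypassed u e = {x \<in> V. u \<in> below x \<and> (fst e \<in> root_side x \<or> snd e \<in> root_side x)}"

definition outreached_by :: "'v link \<Rightarrow> 'v link set \<Rightarrow> bool" where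
  "outreached_by e F \<longleftrightarrow> (\<forall>u. incident u e \<longrightarrow> (\<exists>f\<in>F. incident u f \<and> bypassed u e \<subseteq> bypassed u f))"

definition represented_by :: "'v link \<Rightarrow> 'v link set \<Rightarrow> bool" where
  "represented_by e F \<longleftrightarrow> outreached_by e F \<and>
     (\<forall>x\<in>V. e \<in> (V - {x}) \<times> (V - {x}) \<longrightarrow> e \<in> reach_without x F)"

definition summary :: "'v link set \<Rightarrow> 'v link set \<Rightarrow> bool" where
  "summary X F \<longleftrightarrow> F \<subseteq> X \<and> card F \<le> 2 * card V \<and> (\<forall>e\<in>X. represented_by e F)"

lemma bypassed_nested: "bypassed u e \<subseteq> bypassed u f \<or> bypassed u f \<subseteq> bypassed u e"
proof (rule ccontr)
  assume "\<not> ?thesis"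
  then obtain x y where xy: "x \<in> bypassed u e" "x \<notin> bypassed u f"
    "y \<in> bypassed u f" "y \<notin> bypassed u e" by blast
  then have "x \<in> below y \<or> y \<in> below x"
    using below_chain[of u x y] by (auto simp: bypassed_def)
  then show False using xy root_side_antimono by (fastforce simp: bypassed_def)
qed

lemma bypassed_reaches_root_side:
  assumes "incident u f" "f \<in> F" "x \<in> bypassed u f" "z \<in> root_side x"
  shows "(u, z) \<in> reach_without x F"
proof -
  obtain t where t: "t \<in> root_side x" "t = fst f \<or> t = snd f" and u: "u \<in> below x"
    using assms(3) by (auto simp: bypassed_def)
  have "t \<noteq> u" using t u belowD by blast
  then have f: "f = (u, t) \<or> f = (t, u)"
    using assms(1) t(2) by (cases f) (auto simp: incident_def)
  then have "f \<in> reach_without x F"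
    using links_subset_link_reach[of F "V - {x}" E] assms(2) t(1) u belowD root_sideD
    by blast
  then have "(u, t) \<in> reach_without x F" using f by (auto intro: reach_sym)
  moreover have "(t, z) \<in> reach_without x F"
    using root_side_reach t(1) assms(4) reach_subset_link_reach[of "V - {x}" E F] by blast
  ultimately show ?thesis by (rule rtrancl_trans)
qed

lemma outreached_below_root_side:
  assumes "outreached_by e F" "e = (a, b) \<or> e = (b, a)" "x \<in> V" "a \<in> below x" "b \<in> root_side x"
  shows "(a, b) \<in> reach_without x F"
proof -
  have "incident a e" "x \<in> bypassed a e"
    using assms(2-) by (auto simp: incident_def bypassed_def)
  then obtain f where "f \<in> F" "incident a f" "x \<in> bypassed a f"
    using assms(1) unfolding outreached_by_def by blast
  then show ?thesis using bypassed_reaches_root_side assms(5) by blast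
qed

lemma outreached_reach_without:
  assumes "outreached_by (a, b) F" "x \<in> V" "a \<in> V - {x}" "b \<in> V - {x}"
    and "a \<in> below x \<Longrightarrow> b \<in> below x \<Longrightarrow> (a, b) \<in> reach_without x F"
  shows "(a, b) \<in> reach_without x F"
proof -
  consider "a \<in> root_side x" "b \<in> root_side x" | "a \<in> below x" "b \<in> root_side x"
    | "a \<in> root_side x" "b \<in> below x" | "a \<in> below x" "b \<in> below x"
    using assms(3,4) root_side_or_below by blast
  then show ?thesis
  proof cases
    case 1
    then show ?thesis
      using root_side_reach reach_subset_link_reach[of "V - {x}" E F] by blast
  next
    case 2
    then show ?thesis using outreached_below_root_side assms(1,2) by blast
  next
    case 3
    then show ?thesis
      using outreached_below_root_side[of "(a, b)" F b a x] assms(1,2) by (auto intro: reach_sym)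
  qed (rule assms(5))
qed

lemma represented_by_mono:
  assumes "represented_by e F" "F \<subseteq> F'"
  shows "represented_by e F'"
proof -
  have "reach_without x F \<subseteq> reach_without x F'" for x by (rule link_reach_mono) (rule assms(2))
  then show ?thesis using assms unfolding represented_by_def outreached_by_def by (meson subsetD)
qed

lemma represented_by_trans:
  assumes "represented_by e F" "\<And>f. f \<in> F \<Longrightarrow> represented_by f F'"
  shows "represented_by e F'"
proof -
  have "reach_without x F \<subseteq> reach_without x F'" if "x \<in> V" for x
    using assms(2) that unfolding represented_by_def link_reach_subset_iff by blast
  moreover have "outreached_by e F'"
    using assms unfolding represented_by_def outreached_by_def by (meson order_trans)
  ultimately show ?thesis using assms(1) unfolding represented_by_def by blast
qed

lemma summary_insert:
  assumes "summary X F" "summary (insert e F) F'"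
  shows "summary (insert e X) F'"
proof -
  have F': "represented_by f F'" if "f \<in> insert e F" for f
    using assms(2) that unfolding summary_def by blast
  have "represented_by d F'" if "d \<in> insert e X" for d
  proof (cases "d = e")
    case True
    then show ?thesis using F' by blast
  next
    case False
    then have "represented_by d F" using that assms(1) unfolding summary_def by blast
    then show ?thesis by (rule represented_by_trans) (use F' in blast)
  qed
  moreover have "F' \<subseteq> insert e X" "card F' \<le> 2 * card V"
    using assms by (auto simp: summary_def)
  ultimately show ?thesis by (simp add: summary_def)
qed

lemma furthest_reaching_link_exists:
  assumes "finite X" "\<exists>e\<in>X. incident u e"
  shows "\<exists>f\<in>X. incident u f \<and> (\<forall>e\<in>X. incident u e \<longrightarrow> bypassed u e \<subseteq> bypassed u f)"
proof -
  let ?B = "bypassed u ` {e \<in> X. incident u e}"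
  have "subset.chain UNIV ?B"
    unfolding subset.chain_def using bypassed_nested by blast
  then have "\<Union>?B \<in> ?B" using assms by (intro Union_in_chain) auto
  then obtain f where "f \<in> X" "incident u f" "bypassed u f = \<Union>?B" by auto
  then show ?thesis by blast
qed

lemma outreaching_links_exist:
  assumes "X \<subseteq> V \<times> V"
  shows "\<exists>F\<subseteq>X. card F \<le> card V \<and> (\<forall>e\<in>X. outreached_by e F)"
proof -
  let ?U = "{u \<in> V. \<exists>e\<in>X. incident u e}"
  have "finite X" using assms finite_V finite_subset by blast
  then have "\<forall>u\<in>?U. \<exists>f. f \<in> X \<and> incident u f \<and> (\<forall>e\<in>X. incident u e \<longrightarrow> bypassed u e \<subseteq> bypassed u f)"
    using furthest_reaching_link_exists by blast
  from bchoice[OF this] obtain best where best: "\<And>u. u \<in> ?U \<Longrightarrow> best u \<in> X \<and>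
      incident u (best u) \<and> (\<forall>e\<in>X. incident u e \<longrightarrow> bypassed u e \<subseteq> bypassed u (best u))"
    by blast
  have "card (best ` ?U) \<le> card ?U" using finite_V by (intro card_image_le) auto
  also have "\<dots> \<le> card V" using finite_V by (intro card_mono) auto
  finally have "card (best ` ?U) \<le> card V" .
  moreover have "outreached_by e (best ` ?U)" if "e \<in> X" for e
    unfolding outreached_by_def
  proof (intro allI impI)
    fix u assume u: "incident u e"
    then have "u \<in> ?U" using that assms by (auto simp: incident_def)
    then show "\<exists>f\<in>best ` ?U. incident u f \<and> bypassed u e \<subseteq> bypassed u f"
      using best[of u] that u by blast
  qed
  ultimately show ?thesis using best by (intro exI[of _ "best ` ?U"]) blast
qed

lemma summary_exists:
  assumes "X \<subseteq> V \<times> V"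
  shows "\<exists>F. summary X F"
proof -
  obtain F\<^sub>1 where F\<^sub>1: "F\<^sub>1 \<subseteq> X" "card F\<^sub>1 \<le> card V" "\<And>e. e \<in> X \<Longrightarrow> outreached_by e F\<^sub>1"
    using outreaching_links_exist[OF assms] by blast
  have "finite X" using assms finite_V finite_subset by blast
  then obtain F\<^sub>2 where F\<^sub>2: "F\<^sub>2 \<subseteq> X" "card F\<^sub>2 \<le> card V"
    "\<And>x. x \<in> V \<Longrightarrow> X \<inter> below x \<times> below x \<subseteq> reach_without x F\<^sub>2"
    using sparse_links_below by meson
  have "represented_by e (F\<^sub>1 \<union> F\<^sub>2)" if e: "e \<in> X" for e
    unfolding represented_by_def
  proof (intro conjI ballI impI)
    show outreached: "outreached_by e (F\<^sub>1 \<union> F\<^sub>2)"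
      using F\<^sub>1(3)[OF e] unfolding outreached_by_def by blast
    fix x assume x: "x \<in> V" "e \<in> (V - {x}) \<times> (V - {x})"
    then obtain a b where ab: "e = (a, b)" "a \<in> V - {x}" "b \<in> V - {x}" by blast
    have "(a, b) \<in> reach_without x (F\<^sub>1 \<union> F\<^sub>2)" if "a \<in> below x" "b \<in> below x"
      using F\<^sub>2(3)[OF x(1)] e ab(1) that link_reach_mono[of F\<^sub>2 "F\<^sub>1 \<union> F\<^sub>2"] by blast
    then show "e \<in> reach_without x (F\<^sub>1 \<union> F\<^sub>2)"
      using outreached_reach_without outreached x(1) ab by blast
  qed
  moreover have "card (F\<^sub>1 \<union> F\<^sub>2) \<le> 2 * card V"
    using card_Un_le[of F\<^sub>1 F\<^sub>2] F\<^sub>1(2) F\<^sub>2(2) by linarith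
  ultimately have "summary X (F\<^sub>1 \<union> F\<^sub>2)"
    unfolding summary_def using F\<^sub>1(1) F\<^sub>2(1) by blast
  then show ?thesis ..
qed

end

section \<open>Solutions consisting of representing links\<close>

lemma finite_vc_cap_solutions: "finite L \<Longrightarrow> finite (vc_cap_solutions V E L)"
  by (rule finite_subset[of _ "Pow L"]) (auto simp: vc_cap_solutions_def)

lemma vc_cap_opt_le: "finite L \<Longrightarrow> S \<in> vc_cap_solutions V E L \<Longrightarrow> vc_cap_opt V E L w \<le> sum w S"
  by (simp add: vc_cap_opt_def finite_vc_cap_solutions)

lemma vc_cap_opt_attained:
  assumes "finite L" "vc_cap_solutions V E L \<noteq> {}"
  obtains T where "T \<in> vc_cap_solutions V E L" "sum w T = vc_cap_opt V E L w"
proof -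
  have "vc_cap_opt V E L w \<in> sum w ` vc_cap_solutions V E L"
    unfolding vc_cap_opt_def using assms finite_vc_cap_solutions by (intro Min_in) auto
  then show thesis using that by auto
qed

lemma vc_cap_approx_rounded_weights:
  assumes approx: "vc_cap_approx \<alpha> V E L v S" and "finite L" "0 \<le> \<alpha>" "0 \<le> \<beta>"
    and v: "\<And>e. e \<in> L \<Longrightarrow> v e \<le> w e" "\<And>e. e \<in> L \<Longrightarrow> w e \<le> \<beta> * v e"
  shows "vc_cap_approx (\<alpha> * \<beta>) V E L w S"
proof -
  have S: "S \<in> vc_cap_solutions V E L" "sum v S \<le> \<alpha> * vc_cap_opt V E L v"
    using approx by (simp_all add: vc_cap_approx_def)
  obtain T where T: "T \<in> vc_cap_solutions V E L" "sum w T = vc_cap_opt V E L w"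
    using vc_cap_opt_attained[OF \<open>finite L\<close>, of V E w] S(1) by blast
  have sub: "S \<subseteq> L" "T \<subseteq> L" using S(1) T(1) by (auto simp: vc_cap_solutions_def)
  have "vc_cap_opt V E L v \<le> sum v T" by (rule vc_cap_opt_le) (fact \<open>finite L\<close> T(1))+
  also have "\<dots> \<le> vc_cap_opt V E L w"
    unfolding T(2)[symmetric] using v(1) sub(2) by (intro sum_mono) blast
  finally have opt: "vc_cap_opt V E L v \<le> vc_cap_opt V E L w" .
  have "sum w S \<le> \<beta> * sum v S"
    unfolding sum_distrib_left using v(2) sub(1) by (intro sum_mono) blast
  also have "\<dots> \<le> \<beta> * (\<alpha> * vc_cap_opt V E L w)"
    using S(2) opt assms(3,4) by (intro mult_left_mono order_trans[OF S(2)]) auto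
  finally show ?thesis using S(1) by (simp add: vc_cap_approx_def mult_ac)
qed

lemma vc_cap_approx_mono:
  assumes "vc_cap_approx \<alpha> V E L w S" "\<alpha> \<le> \<alpha>'" "finite L" "\<And>e. e \<in> L \<Longrightarrow> 0 \<le> w e"
  shows "vc_cap_approx \<alpha>' V E L w S"
proof -
  have S: "S \<in> vc_cap_solutions V E L" using assms(1) by (simp add: vc_cap_approx_def)
  obtain T where T: "T \<in> vc_cap_solutions V E L" "sum w T = vc_cap_opt V E L w"
    using vc_cap_opt_attained[OF assms(3), of V E w] S by blast
  have "0 \<le> sum w T" using T(1) assms(4) by (intro sum_nonneg) (auto simp: vc_cap_solutions_def)
  then have "\<alpha> * vc_cap_opt V E L w \<le> \<alpha>' * vc_cap_opt V E L w"
    using T(2) assms(2) by (intro mult_right_mono) auto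
  then show ?thesis using assms(1) by (auto simp: vc_cap_approx_def)
qed

context rooted_graph
begin

lemma cheap_outreaching_links_exist:
  fixes w :: "'v link \<Rightarrow> real"
  assumes "finite T" "\<And>e. 0 \<le> w e"
    and "\<And>e. e \<in> T \<Longrightarrow> outreached_by e {f \<in> F. w f \<le> w e}"
  shows "\<exists>P\<subseteq>F. finite P \<and> sum w P \<le> 2 * sum w T \<and> (\<forall>e\<in>T. outreached_by e P)"
proof -
  define p where "p = (\<lambda>u e. SOME f.
      f \<in> F \<and> w f \<le> w e \<and> incident u f \<and> bypassed u e \<subseteq> bypassed u f)"
  have p: "p u e \<in> F \<and> w (p u e) \<le> w e \<and> incident u (p u e) \<and> bypassed u e \<subseteq> bypassed u (p u e)"
    if "e \<in> T" "incident u e" for u e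
  proof -
    have "\<exists>f. f \<in> F \<and> w f \<le> w e \<and> incident u f \<and> bypassed u e \<subseteq> bypassed u f"
      using assms(3)[OF that(1)] that(2) unfolding outreached_by_def by blast
    then show ?thesis unfolding p_def by (rule someI_ex)
  qed
  let ?P = "\<lambda>end. (\<lambda>e. p (end e) e) ` T"
  have cost: "sum w (?P end) \<le> sum w T" if "\<And>e. incident (end e) e" for "end"
  proof -
    have "sum w (?P end) \<le> (\<Sum>e\<in>T. w (p (end e) e))"
      using sum_image_le[OF assms(1), of w "\<lambda>e. p (end e) e"] assms(2) by simp
    also have "\<dots> \<le> sum w T" using p that by (intro sum_mono) blast
    finally show ?thesis .
  qed
  have ends: "incident (fst e) e" "incident (snd e) e" for e :: "'v link"
    by (simp_all add: incident_def)
  have "sum w (?P fst \<union> ?P snd) \<le> 2 * sum w T"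
    using sum_Un_le[of w "?P fst" "?P snd", OF assms(2)] cost[OF ends(1)] cost[OF ends(2)]
    by linarith
  moreover have "?P fst \<union> ?P snd \<subseteq> F" using p ends by blast
  moreover have "finite (?P fst \<union> ?P snd)" using assms(1) by simp
  moreover have "outreached_by e (?P fst \<union> ?P snd)" if "e \<in> T" for e
    unfolding outreached_by_def
  proof (intro allI impI)
    fix u assume u: "incident u e"
    then have "p u e \<in> ?P fst \<union> ?P snd" using that by (auto simp: incident_def)
    then show "\<exists>f\<in>?P fst \<union> ?P snd. incident u f \<and> bypassed u e \<subseteq> bypassed u f"
      using p[OF that u] by blast
  qed
  ultimately show ?thesis by blast
qed

definition split_links :: "'v \<Rightarrow> 'v link set \<Rightarrow> 'v link set" where
  "split_links x T = T \<inter> below x \<times> below x - reach (V - {x}) E"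

lemma sum_split_links_le:
  fixes w :: "'v link \<Rightarrow> real"
  assumes "finite T" "\<And>e. 0 \<le> w e"
  shows "(\<Sum>x\<in>V. sum w (split_links x T)) \<le> sum w T"
proof -
  have "(\<Sum>x\<in>V. sum w (split_links x T)) = sum w (\<Union>x\<in>V. split_links x T)"
  proof (rule sum.UNION_disjoint[symmetric])
    show "\<forall>x\<in>V. finite (split_links x T)" using assms(1) by (simp add: split_links_def)
    show "\<forall>x\<in>V. \<forall>y\<in>V. x \<noteq> y \<longrightarrow> split_links x T \<inter> split_links y T = {}"
      using below_separated_unique by (fastforce simp: split_links_def)
  qed (rule finite_V)
  also have "\<dots> \<le> sum w T"
    using assms by (intro sum_mono2) (auto simp: split_links_def)
  finally show ?thesis .
qed

lemma outreaching_and_split_links_connect: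
  assumes "x \<in> V" "connected_graph (V - {x}) (E \<union> link_edges T)"
    and "\<And>e. e \<in> T \<Longrightarrow> outreached_by e P"
  shows "connected_graph (V - {x}) (E \<union> link_edges (P \<union> split_links x T))"
proof -
  let ?P = "P \<union> split_links x T"
  have "T \<inter> (V - {x}) \<times> (V - {x}) \<subseteq> reach_without x ?P"
  proof (rule subrelI)
    fix a b assume ab: "(a, b) \<in> T \<inter> (V - {x}) \<times> (V - {x})"
    have "(a, b) \<in> reach_without x ?P" if "a \<in> below x" "b \<in> below x"
    proof (cases "(a, b) \<in> reach (V - {x}) E")
      case True
      then show ?thesis using reach_subset_link_reach by blast
    next
      case False
      then have "(a, b) \<in> ?P" using that ab by (simp add: split_links_def)
      then show ?thesis using ab links_subset_link_reach[of ?P "V - {x}" E] by blast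
    qed
    moreover have "outreached_by (a, b) ?P"
      using assms(3) ab unfolding outreached_by_def by blast
    ultimately show "(a, b) \<in> reach_without x ?P"
      using outreached_reach_without assms(1) ab by blast
  qed
  then have "reach_without x T \<subseteq> reach_without x ?P" by (simp only: link_reach_subset_iff)
  then show ?thesis using assms(2) unfolding connected_graph_iff_reach by blast
qed

lemma cheap_connecting_links_exist:
  fixes w :: "'v link \<Rightarrow> real"
  assumes "x \<in> V" "finite T" "\<And>e. 0 \<le> w e"
    and "connected_graph (V - {x}) (E \<union> link_edges T)"
    and "\<And>e. e \<in> T \<Longrightarrow> represented_by e {f \<in> F. w f \<le> w e}"
    and "\<And>e. e \<in> T \<Longrightarrow> outreached_by e P"
  shows "\<exists>B\<subseteq>F. finite B \<and> sum w B \<le> sum w (split_links x T) \<and>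
    connected_graph (V - {x}) (E \<union> link_edges (P \<union> B))"
proof (rule connecting_links_exchange[OF assms(3)])
  show "finite (split_links x T)" using assms(2) by (simp add: split_links_def)
  show sub: "split_links x T \<subseteq> (V - {x}) \<times> (V - {x})"
    using belowD by (auto simp: split_links_def)
  show "e \<in> reach_without x {f \<in> F. w f \<le> w e}" if "e \<in> split_links x T" for e
    using assms(1,5) that sub unfolding represented_by_def split_links_def by blast
  show "connected_graph (V - {x}) (E \<union> link_edges (P \<union> split_links x T))"
    using outreaching_and_split_links_connect assms(1,4,6) by blast
qed

lemma cheap_solution_of_representing_links:
  fixes w :: "'v link \<Rightarrow> real"
  assumes "finite T" "\<And>e. 0 \<le> w e"
    and "vertex_connected 2 V (E \<union> link_edges T)"
    and "\<And>e. e \<in> T \<Longrightarrow> represented_by e {f \<in> F. w f \<le> w e}"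
  shows "\<exists>S\<in>vc_cap_solutions V E F. finite S \<and> sum w S \<le> 3 * sum w T"
proof -
  have T: "2 < card V" "\<And>x. x \<in> V \<Longrightarrow> connected_graph (V - {x}) (E \<union> link_edges T)"
    using assms(3) unfolding vertex_connected_2_iff by blast+
  have outreached: "outreached_by e {f \<in> F. w f \<le> w e}" if "e \<in> T" for e
    using assms(4)[OF that] by (simp add: represented_by_def)
  obtain P where P: "P \<subseteq> F" "finite P" "sum w P \<le> 2 * sum w T" "\<And>e. e \<in> T \<Longrightarrow> outreached_by e P"
    using cheap_outreaching_links_exist[OF assms(1,2) outreached] by blast
  have "\<exists>B\<subseteq>F. finite B \<and> sum w B \<le> sum w (split_links x T) \<and>
      connected_graph (V - {x}) (E \<union> link_edges (P \<union> B))" if "x \<in> V" for x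
    by (rule cheap_connecting_links_exist[OF that assms(1,2) T(2)[OF that] assms(4) P(4)])
  then obtain B where B: "\<And>x. x \<in> V \<Longrightarrow> B x \<subseteq> F \<and> finite (B x) \<and>
      sum w (B x) \<le> sum w (split_links x T) \<and> connected_graph (V - {x}) (E \<union> link_edges (P \<union> B x))"
    by metis
  let ?S = "P \<union> (\<Union>x\<in>V. B x)"
  have "sum w (\<Union>x\<in>V. B x) \<le> (\<Sum>x\<in>V. sum w (B x))" using finite_V assms(2) by (rule sum_UN_le)
  also have "\<dots> \<le> (\<Sum>x\<in>V. sum w (split_links x T))" using B by (intro sum_mono) blast
  also have "\<dots> \<le> sum w T" using assms(1,2) by (rule sum_split_links_le)
  finally have "sum w ?S \<le> 3 * sum w T"
    using P(3) sum_Un_le[of w P "\<Union>x\<in>V. B x", OF assms(2)] by linarith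
  moreover have "connected_graph (V - {x}) (E \<union> link_edges ?S)" if "x \<in> V" for x
  proof -
    have "reach_without x (P \<union> B x) \<subseteq> reach_without x ?S"
      using that by (intro link_reach_mono) blast
    then show ?thesis using B[OF that] unfolding connected_graph_iff_reach by blast
  qed
  moreover have "?S \<subseteq> F" "finite ?S" using P(1,2) B finite_V by auto
  ultimately show ?thesis
    using T(1) by (intro bexI[of _ ?S]) (auto simp: vc_cap_solutions_def vertex_connected_2_iff)
qed

lemma min_solution_of_representing_links_approx:
  fixes w :: "'v link \<Rightarrow> real"
  assumes "finite L" "F \<subseteq> L" "\<And>e. 0 \<le> w e"
    and "\<And>e. e \<in> L \<Longrightarrow> represented_by e {f \<in> F. w f \<le> w e}"
    and "vc_cap_solutions V E L \<noteq> {}"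
    and "\<And>S'. S' \<in> vc_cap_solutions V E F \<Longrightarrow> S \<in> vc_cap_solutions V E F \<and> sum w S \<le> sum w S'"
  shows "vc_cap_approx 3 V E L w S"
proof -
  obtain T where T: "T \<in> vc_cap_solutions V E L" "sum w T = vc_cap_opt V E L w"
    using vc_cap_opt_attained[OF assms(1,5)] by blast
  then have T': "T \<subseteq> L" "vertex_connected 2 V (E \<union> link_edges T)"
    by (auto simp: vc_cap_solutions_def)
  then have "finite T" using assms(1) finite_subset by blast
  then obtain S' where "S' \<in> vc_cap_solutions V E F" "sum w S' \<le> 3 * sum w T"
    using cheap_solution_of_representing_links[of T w F] assms(3,4) T' by blast
  then have "S \<in> vc_cap_solutions V E F" "sum w S \<le> 3 * vc_cap_opt V E L w"
    using assms(6) T(2) by fastforce+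
  then show ?thesis using assms(2) by (auto simp: vc_cap_approx_def vc_cap_solutions_def)
qed

text \<open>The stored links carry no weights: the number of the class of a link, which is the only \<open>i\<close>
  with \<open>e \<in> F i\<close>, stands in for its weight.\<close>

definition best_stored_solution :: "real \<Rightarrow> (nat \<Rightarrow> 'v link set) \<Rightarrow> 'v link set" where
  "best_stored_solution \<beta> F =
     arg_min_on (sum (\<lambda>e. \<beta> ^ (LEAST i. e \<in> F i))) (vc_cap_solutions V E (\<Union>i. F i))"

lemma best_stored_solution_approx:
  assumes "L \<subseteq> V \<times> V" "0 \<le> \<beta>" "vc_cap_solutions V E L \<noteq> {}"
    and F: "\<And>i. summary {e \<in> L. c e = i} (F i)"
  shows "vc_cap_approx 3 V E L (\<lambda>e. \<beta> ^ c e) (best_stored_solution \<beta> F)"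
proof (rule min_solution_of_representing_links_approx[where F = "\<Union>i. F i"])
  let ?F = "\<Union>i. F i" and ?w = "\<lambda>e. \<beta> ^ c e" and ?v = "\<lambda>e. \<beta> ^ (LEAST i. e \<in> F i)"
  have sub: "F i \<subseteq> {e \<in> L. c e = i}" for i using F unfolding summary_def by blast
  then show FL: "?F \<subseteq> L" by blast
  show finL: "finite L" using assms(1) finite_V finite_subset by blast
  show "represented_by e {f \<in> ?F. ?w f \<le> ?w e}" if "e \<in> L" for e
  proof (rule represented_by_mono)
    show "represented_by e (F (c e))" using F[of "c e"] that unfolding summary_def by blast
    show "F (c e) \<subseteq> {f \<in> ?F. ?w f \<le> ?w e}" using sub[of "c e"] by auto
  qed
  fix S assume S: "S \<in> vc_cap_solutions V E ?F"
  have "(LEAST i. e \<in> F i) = c e" if "e \<in> ?F" for e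
    using that sub by (intro Least_equality) blast+
  then have weights: "sum ?v S' = sum ?w S'" if "S' \<in> vc_cap_solutions V E ?F" for S'
    using that unfolding vc_cap_solutions_def
    by (intro sum.cong refl arg_cong[of _ _ "power \<beta>"]) blast
  have fin: "finite (vc_cap_solutions V E ?F)"
    using finite_subset[OF FL finL] by (rule finite_vc_cap_solutions)
  have "best_stored_solution \<beta> F \<in> vc_cap_solutions V E ?F"
    unfolding best_stored_solution_def using arg_min_if_finite(1)[OF fin] S by blast
  moreover have "sum ?v (best_stored_solution \<beta> F) \<le> sum ?v S"
    unfolding best_stored_solution_def using arg_min_least[OF fin _ S] S by blast
  ultimately show "best_stored_solution \<beta> F \<in> vc_cap_solutions V E ?F \<and>
      sum ?w (best_stored_solution \<beta> F) \<le> sum ?w S"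
    using weights S by simp
qed (use assms(2,3) in auto)

end

section \<open>Storing one coreset per weight class\<close>

definition element_code :: "'a set \<Rightarrow> 'a \<Rightarrow> nat" where
  "element_code U = (SOME h. bij_betw h U {1..card U})"

text \<open>Class \<open>i\<close> occupies the words \<open>i * m, ..., i * m + m - 1\<close>. The class is thus encoded by the
  position, since its number need not fit into a word; the word \<open>0\<close> marks an empty slot.\<close>

definition padded :: "nat \<Rightarrow> nat set \<Rightarrow> nat list" where
  "padded m N = sorted_list_of_set N @ replicate (m - card N) 0"

definition pack :: "'a set \<Rightarrow> nat \<Rightarrow> nat \<Rightarrow> (nat \<Rightarrow> 'a set) \<Rightarrow> nat list" where
  "pack U m K F = concat (map (\<lambda>i. padded m (element_code U ` F i)) [0..<K])"

definition unpack :: "'a set \<Rightarrow> nat \<Rightarrow> nat list \<Rightarrow> nat \<Rightarrow> 'a set" where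
  "unpack U m mem i = {e \<in> U. element_code U e \<in> set (take m (drop (i * m) mem))}"

definition storable :: "'a set \<Rightarrow> nat \<Rightarrow> nat \<Rightarrow> (nat \<Rightarrow> 'a set) \<Rightarrow> bool" where
  "storable U m K F \<longleftrightarrow> (\<forall>i. F i \<subseteq> U \<and> card (F i) \<le> m) \<and> (\<forall>i\<ge>K. F i = {})"

lemma bij_betw_element_code:
  assumes "finite U"
  shows "bij_betw (element_code U) U {1..card U}"
proof -
  have "\<exists>h. bij_betw h U {1..card U}" using assms by (intro finite_same_card_bij) auto
  then show ?thesis unfolding element_code_def by (rule someI_ex)
qed

lemma length_padded: "card N \<le> m \<Longrightarrow> length (padded m N) = m"
  by (simp add: padded_def)

lemma set_padded: "finite N \<Longrightarrow> N \<subseteq> set (padded m N) \<and> set (padded m N) \<subseteq> insert 0 N"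
  by (auto simp: padded_def)

lemma take_drop_concat:
  assumes "\<And>xs. xs \<in> set xss \<Longrightarrow> length xs = m"
  shows "take m (drop (i * m) (concat xss)) = (if i < length xss then xss ! i else [])"
  using assms
proof (induction xss arbitrary: i)
  case (Cons xs xss)
  then have "length xs = m"
    "\<And>i. take m (drop (i * m) (concat xss)) = (if i < length xss then xss ! i else [])"
    by auto
  then show ?case by (cases i) simp_all
qed simp

context
  fixes U :: "'a set" and m K :: nat and F :: "nat \<Rightarrow> 'a set"
  assumes finite_U: "finite U" and storable: "storable U m K F"
begin

lemma storable_codes: "finite (element_code U ` F i)" "card (element_code U ` F i) \<le> m"
proof -
  have "finite (F i)" "card (F i) \<le> m"
    using finite_U storable finite_subset by (auto simp: storable_def)
  then show "finite (element_code U ` F i)" "card (element_code U ` F i) \<le> m"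
    using card_image_le order_trans by blast+
qed

lemma length_pack: "length (pack U m K F) = K * m"
  by (simp add: pack_def length_concat comp_def length_padded storable_codes sum_list_triv)

lemma pack_words_le:
  assumes "x \<in> set (pack U m K F)"
  shows "x \<le> card U"
proof -
  obtain i where "x \<in> set (padded m (element_code U ` F i))"
    using assms by (auto simp: pack_def)
  then have "x = 0 \<or> x \<in> element_code U ` U"
    using set_padded[OF storable_codes(1)] storable unfolding storable_def by blast
  then show ?thesis using bij_betw_element_code[OF finite_U] by (auto simp: bij_betw_def)
qed

lemma unpack_pack: "unpack U m (pack U m K F) = F"
proof
  fix i
  have code: "inj_on (element_code U) U" "0 \<notin> element_code U ` U"
    using bij_betw_element_code[OF finite_U] by (auto simp: bij_betw_def)
  have FU: "F i \<subseteq> U" using storable by (simp add: storable_def)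
  have block: "take m (drop (i * m) (pack U m K F)) =
      (if i < K then padded m (element_code U ` F i) else [])"
    unfolding pack_def by (subst take_drop_concat) (auto simp: length_padded storable_codes)
  show "unpack U m (pack U m K F) i = F i"
  proof (cases "i < K")
    case True
    have "element_code U e \<in> set (padded m (element_code U ` F i)) \<longleftrightarrow> e \<in> F i" if "e \<in> U" for e
    proof -
      have "element_code U e \<in> set (padded m (element_code U ` F i)) \<longleftrightarrow>
          element_code U e \<in> element_code U ` F i"
        using set_padded[OF storable_codes(1)] code(2) that by (metis imageI insertE subsetD)
      also have "\<dots> \<longleftrightarrow> e \<in> F i" using code(1) FU that by (meson inj_on_image_mem_iff)
      finally show ?thesis .
    qed
    then show ?thesis using True FU by (auto simp: unpack_def block)
  next
    case False
    then show ?thesis using storable by (simp add: unpack_def block storable_def)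
  qed
qed

end

locale coreset_scheme =
  fixes U :: "'a set" and m :: nat and coreset :: "'a set \<Rightarrow> 'a set \<Rightarrow> bool"
  assumes finite_U: "finite U"
    and coreset_subset: "coreset X F \<Longrightarrow> F \<subseteq> X"
    and coreset_card: "coreset X F \<Longrightarrow> card F \<le> m"
    and coreset_exists: "X \<subseteq> U \<Longrightarrow> \<exists>F. coreset X F"
    and coreset_insert: "coreset X F \<Longrightarrow> coreset (insert e F) F' \<Longrightarrow> coreset (insert e X) F'"
begin

definition class_algorithm ::
    "nat \<Rightarrow> (real \<Rightarrow> nat) \<Rightarrow> ((nat \<Rightarrow> 'a set) \<Rightarrow> 'out) \<Rightarrow> ('a \<times> real, 'out) streaming_algorithm"
  where
  "class_algorithm K cls ans =
     \<lparr>init_mem = pack U m K (\<lambda>_. {}),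
      process = (\<lambda>(e, x) mem. let F = unpack U m mem; i = cls x
                  in pack U m K (F(i := SOME G. coreset (insert e (F i)) G))),
      answer = (\<lambda>mem. ans (unpack U m mem))\<rparr>"

definition class_coresets :: "(real \<Rightarrow> nat) \<Rightarrow> ('a \<Rightarrow> real) \<Rightarrow> 'a set \<Rightarrow> (nat \<Rightarrow> 'a set) \<Rightarrow> bool" where
  "class_coresets cls w X F \<longleftrightarrow> (\<forall>i. coreset {e \<in> X. cls (w e) = i} (F i))"

lemma class_coresets_empty: "class_coresets cls w {} (\<lambda>_. {})"
proof -
  obtain F where "coreset {} F" using coreset_exists by blast
  moreover from this have "F = {}" using coreset_subset by blast
  ultimately show ?thesis by (simp add: class_coresets_def)
qed

lemma class_coresets_insert:
  assumes F: "class_coresets cls w X F" and "insert e X \<subseteq> U"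
  defines "i \<equiv> cls (w e)"
  shows "class_coresets cls w (insert e X) (F(i := SOME G. coreset (insert e (F i)) G))"
proof -
  let ?G = "SOME G. coreset (insert e (F i)) G"
  have Fi: "coreset {d \<in> X. cls (w d) = j} (F j)" for j
    using F by (simp add: class_coresets_def)
  have "insert e (F i) \<subseteq> U" using coreset_subset[OF Fi[of i]] assms(2) by blast
  then have "coreset (insert e (F i)) ?G" by (rule someI_ex[OF coreset_exists])
  then have "coreset (insert e {d \<in> X. cls (w d) = i}) ?G" by (rule coreset_insert[OF Fi])
  moreover have "{d \<in> insert e X. cls (w d) = j} =
      (if j = i then insert e {d \<in> X. cls (w d) = i} else {d \<in> X. cls (w d) = j})" for j
    by (auto simp: i_def)
  ultimately show ?thesis using Fi by (simp add: class_coresets_def)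
qed

lemma class_coresets_storable:
  assumes F: "class_coresets cls w X F" and "X \<subseteq> U" "\<And>e. e \<in> X \<Longrightarrow> cls (w e) < K"
  shows "storable U m K F"
proof -
  have Fi: "coreset {e \<in> X. cls (w e) = i} (F i)" for i
    using F by (simp add: class_coresets_def)
  have "F i \<subseteq> U" "card (F i) \<le> m" for i
    using coreset_subset[OF Fi] coreset_card[OF Fi] assms(2) by blast+
  moreover have "F i = {}" if "K \<le> i" for i
    using coreset_subset[OF Fi] assms(3) that by fastforce
  ultimately show ?thesis by (simp add: storable_def)
qed

lemma class_algorithm_memory:
  assumes "set xs \<subseteq> U" "\<And>e. e \<in> set xs \<Longrightarrow> cls (w e) < K"
  shows "\<exists>F. memory_after (class_algorithm K cls ans) (weighted_stream w xs) = pack U m K F \<and>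
    class_coresets cls w (set xs) F"
  using assms
proof (induction xs rule: rev_induct)
  case Nil
  then show ?case
    using class_coresets_empty
    by (auto simp: memory_after_def weighted_stream_def class_algorithm_def)
next
  case (snoc e xs)
  let ?A = "class_algorithm K cls ans"
  obtain F where F: "memory_after ?A (weighted_stream w xs) = pack U m K F"
    "class_coresets cls w (set xs) F"
    using snoc.IH snoc.prems by auto
  then have "storable U m K F" using class_coresets_storable snoc.prems by auto
  then have "unpack U m (pack U m K F) = F" by (rule unpack_pack[OF finite_U])
  then have "memory_after ?A (weighted_stream w (xs @ [e])) =
      pack U m K (F(cls (w e) := SOME G. coreset (insert e (F (cls (w e)))) G))"
    using F(1) by (simp add: memory_after_def weighted_stream_def class_algorithm_def Let_def)
  moreover have "class_coresets cls w (set (xs @ [e]))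
      (F(cls (w e) := SOME G. coreset (insert e (F (cls (w e)))) G))"
    using class_coresets_insert[OF F(2), of e] snoc.prems(1) by simp
  ultimately show ?case by blast
qed

lemma class_algorithm_runs_in_space:
  assumes "set xs \<subseteq> U" "\<And>e. e \<in> set xs \<Longrightarrow> cls (w e) < K"
    and "card U < 2 ^ b" "real (K * m) \<le> s"
  shows "runs_in_space (class_algorithm K cls ans) b s (weighted_stream w xs)"
  unfolding runs_in_space_def
proof (intro allI impI)
  fix k
  let ?mem = "memory_after (class_algorithm K cls ans) (take k (weighted_stream w xs))"
  have prefix: "set (take k xs) \<subseteq> set xs" by (rule set_take_subset)
  have "take k (weighted_stream w xs) = weighted_stream w (take k xs)"
    by (simp add: weighted_stream_def take_map)
  then obtain F where F: "?mem = pack U m K F" "class_coresets cls w (set (take k xs)) F"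
    using class_algorithm_memory[of "take k xs" cls w K ans] assms(1,2) prefix by auto
  have "storable U m K F"
    by (rule class_coresets_storable[OF F(2)]) (use assms(1,2) prefix in blast)+
  then show "real (length ?mem) \<le> s \<and> (\<forall>x\<in>set ?mem. x < 2 ^ b)"
    using length_pack[OF finite_U] pack_words_le[OF finite_U] assms(3,4) unfolding F(1)
    by (metis le_less_trans)
qed

lemma class_algorithm_result:
  assumes "set xs \<subseteq> U" "\<And>e. e \<in> set xs \<Longrightarrow> cls (w e) < K"
  obtains F where "stream_result (class_algorithm K cls ans) (weighted_stream w xs) = ans F"
    and "class_coresets cls w (set xs) F"
proof -
  obtain F where F: "memory_after (class_algorithm K cls ans) (weighted_stream w xs) = pack U m K F"
    "class_coresets cls w (set xs) F"
    using class_algorithm_memory[of xs cls w K ans] assms by blast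
  then have "unpack U m (pack U m K F) = F"
    using unpack_pack[OF finite_U] class_coresets_storable assms by blast
  then show thesis
    using that F by (simp add: stream_result_def class_algorithm_def)
qed

end

section \<open>Geometric weight classes\<close>

definition weight_class :: "real \<Rightarrow> real \<Rightarrow> nat" where
  "weight_class \<beta> x = nat \<lfloor>log \<beta> x\<rfloor>"

lemma weight_class_bounds:
  assumes "1 < \<beta>" "1 \<le> x"
  shows "\<beta> ^ weight_class \<beta> x \<le> x" "x \<le> \<beta> * \<beta> ^ weight_class \<beta> x"
proof -
  have "0 \<le> log \<beta> x" using assms by simp
  then have "real (weight_class \<beta> x) \<le> log \<beta> x" "log \<beta> x \<le> real (Suc (weight_class \<beta> x))"
    unfolding weight_class_def by linarith+
  then have "\<beta> powr real (weight_class \<beta> x) \<le> x" "x \<le> \<beta> powr real (Suc (weight_class \<beta> x))"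
    using assms by (simp_all only: le_log_iff log_le_iff)
  then show "\<beta> ^ weight_class \<beta> x \<le> x" "x \<le> \<beta> * \<beta> ^ weight_class \<beta> x"
    using assms by (simp_all only: powr_realpow power_Suc)
qed

lemma weight_class_mono: "1 < \<beta> \<Longrightarrow> 1 \<le> x \<Longrightarrow> x \<le> y \<Longrightarrow> weight_class \<beta> x \<le> weight_class \<beta> y"
  unfolding weight_class_def by (intro nat_mono floor_mono) simp

lemma weight_class_le:
  assumes "0 < \<delta>" "\<delta> \<le> 1" "1 \<le> x"
  shows "real (weight_class (1 + \<delta>) x) \<le> 2 / \<delta> * log 2 x"
proof -
  have "\<delta> / 2 \<le> \<delta> / (1 + \<delta>)" using assms by (intro divide_left_mono) auto
  also have "\<dots> \<le> ln (1 + \<delta>)"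
    using ln_diff_le[of 1 "1 + \<delta>"] assms(1) by (simp add: field_simps)
  finally have ln_ge: "\<delta> / 2 \<le> ln (1 + \<delta>)" .
  have ln_x: "0 \<le> ln x" using assms(3) by simp
  have "real (weight_class (1 + \<delta>) x) \<le> log (1 + \<delta>) x"
    unfolding weight_class_def using assms by simp
  also have "\<dots> \<le> ln x / (\<delta> / 2)"
    unfolding log_def using ln_ge ln_x assms(1) by (intro divide_left_mono) auto
  also have "\<dots> = 2 / \<delta> * ln x" by simp
  also have "ln x \<le> log 2 x"
    using mult_left_le[of "ln 2" "ln x"] ln_x ln_2_less_1 by (simp add: log_def field_simps)
  then have "2 / \<delta> * ln x \<le> 2 / \<delta> * log 2 x" using assms(1) by (intro mult_left_mono) auto
  finally show ?thesis .
qed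

definition rounding_base :: "real \<Rightarrow> real" where
  "rounding_base \<epsilon> = 1 + min 1 (\<epsilon> / 3)"

lemma rounding_base_bounds:
  assumes "0 < \<epsilon>"
  shows "1 < rounding_base \<epsilon>" "3 * rounding_base \<epsilon> \<le> 3 + \<epsilon>"
  using assms by (auto simp: rounding_base_def)

lemma weight_class_count_le:
  assumes "0 < \<epsilon>" "1 \<le> W"
  shows "real (Suc (weight_class (rounding_base \<epsilon>) W)) \<le> 7 * max 1 (1 / \<epsilon>) * max 1 (log 2 W)"
proof -
  let ?\<delta> = "min 1 (\<epsilon> / 3)" and ?M = "max 1 (1 / \<epsilon>)" and ?L = "max 1 (log 2 W)"
  have "real (weight_class (1 + ?\<delta>) W) \<le> 2 / ?\<delta> * log 2 W"
    using assms by (intro weight_class_le) auto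
  also have "\<dots> \<le> (6 * ?M) * ?L"
  proof (rule mult_mono)
    show "2 / ?\<delta> \<le> 6 * ?M"
      using assms(1) by (auto simp: min_def max_def field_simps)
  qed (use assms in auto)
  finally have "real (weight_class (1 + ?\<delta>) W) \<le> 6 * (?M * ?L)" by simp
  moreover have "1 * 1 \<le> ?M * ?L" by (intro mult_mono) auto
  ultimately show ?thesis by (simp add: rounding_base_def mult.assoc)
qed

lemma power_less_two_power_word_bits:
  assumes "0 < c"
  shows "n ^ c < 2 ^ word_bits c n"
proof -
  define k where "k = nat \<lceil>log 2 (real n + 1)\<rceil>"
  have "log 2 (real n + 1) \<le> real k" unfolding k_def by linarith
  then have "real n + 1 \<le> 2 powr real k" by (simp add: log_le_iff)
  then have "real (n + 1) \<le> real (2 ^ k)" by (simp add: powr_realpow)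
  then have "n < 2 ^ k" by linarith
  then have "n ^ c < (2 ^ k) ^ c" using assms by (intro power_strict_mono) auto
  then show ?thesis
    by (simp add: word_bits_def k_def[symmetric] power_mult[symmetric] mult.commute)
qed

section \<open>The algorithm\<close>

context rooted_graph
begin

sublocale coreset_scheme "V \<times> V" "2 * card V" summary
proof
  show "finite (V \<times> V)" using finite_V by simp
  show "F \<subseteq> X" "card F \<le> 2 * card V" if "summary X F" for X F
    using that by (simp_all add: summary_def)
qed (fact summary_exists summary_insert)+

definition vc_cap_algorithm :: "real \<Rightarrow> real \<Rightarrow> ('v link \<times> real, 'v link set) streaming_algorithm"
  where
  "vc_cap_algorithm W \<epsilon> = (let \<beta> = rounding_base \<epsilon> in
     class_algorithm (Suc (weight_class \<beta> W)) (weight_class \<beta>) (best_stored_solution \<beta>))"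

context
  fixes W \<epsilon> :: real and L :: "'v link set" and w :: "'v link \<Rightarrow> real" and xs :: "'v link list"
  assumes \<epsilon>: "0 < \<epsilon>" and links: "L \<subseteq> V \<times> V" and weights: "\<forall>e\<in>L. 1 \<le> w e \<and> w e \<le> W"
    and order: "arrival_order L xs"
begin

lemma stream_weight_class_less:
  assumes "1 < \<beta>" "e \<in> set xs"
  shows "weight_class \<beta> (w e) < Suc (weight_class \<beta> W)"
  using weight_class_mono[OF assms(1)] assms(2) weights order
  by (simp add: arrival_order_def le_imp_less_Suc)

lemma vc_cap_algorithm_runs_in_space:
  assumes "1 \<le> W"
  shows "runs_in_space (vc_cap_algorithm W \<epsilon>) (word_bits 2 (card V)) (14 * space_bound (card V) W \<epsilon>)
    (weighted_stream w xs)"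
  unfolding vc_cap_algorithm_def Let_def
proof (rule class_algorithm_runs_in_space)
  let ?K = "Suc (weight_class (rounding_base \<epsilon>) W)"
  show "set xs \<subseteq> V \<times> V" using order links by (simp add: arrival_order_def)
  show "weight_class (rounding_base \<epsilon>) (w e) < ?K" if "e \<in> set xs" for e
    using rounding_base_bounds(1)[OF \<epsilon>] that by (rule stream_weight_class_less)
  show "card (V \<times> V) < 2 ^ word_bits 2 (card V)"
    using power_less_two_power_word_bits[of 2 "card V"]
    by (simp add: card_cartesian_product power2_eq_square)
  have "real (?K * (2 * card V)) = 2 * real (card V) * real ?K" by (simp add: algebra_simps)
  also have "\<dots> \<le> 2 * real (card V) * (7 * max 1 (1 / \<epsilon>) * max 1 (log 2 W))"
    by (intro mult_left_mono weight_class_count_le \<epsilon> assms) simp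
  also have "\<dots> = 14 * space_bound (card V) W \<epsilon>" by (simp add: space_bound_def)
  finally show "real (?K * (2 * card V)) \<le> 14 * space_bound (card V) W \<epsilon>" .
qed

lemma vc_cap_algorithm_approx:
  assumes "vc_cap_solutions V E L \<noteq> {}"
  shows "vc_cap_approx (3 + \<epsilon>) V E L w
    (stream_result (vc_cap_algorithm W \<epsilon>) (weighted_stream w xs))"
proof -
  define \<beta> where "\<beta> = rounding_base \<epsilon>"
  have \<beta>: "1 < \<beta>" "3 * \<beta> \<le> 3 + \<epsilon>" unfolding \<beta>_def by (rule rounding_base_bounds[OF \<epsilon>])+
  have xs: "set xs = L" using order by (simp add: arrival_order_def)
  have fin: "finite L" unfolding xs[symmetric] by simp
  obtain F where F:
    "stream_result (vc_cap_algorithm W \<epsilon>) (weighted_stream w xs) = best_stored_solution \<beta> F"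
    "class_coresets (weight_class \<beta>) w L F"
    using class_algorithm_result[of xs "weight_class \<beta>" w "Suc (weight_class \<beta> W)"
        "best_stored_solution \<beta>"] stream_weight_class_less[OF \<beta>(1)] links
    unfolding vc_cap_algorithm_def Let_def \<beta>_def[symmetric] xs by blast
  have "vc_cap_approx 3 V E L (\<lambda>e. \<beta> ^ weight_class \<beta> (w e)) (best_stored_solution \<beta> F)"
    using best_stored_solution_approx[of L \<beta> "\<lambda>e. weight_class \<beta> (w e)" F] links \<beta>(1) assms F(2)
    by (simp add: class_coresets_def)
  then have "vc_cap_approx (3 * \<beta>) V E L w (best_stored_solution \<beta> F)"
    using weight_class_bounds[OF \<beta>(1)] weights \<beta>(1) fin
    by (intro vc_cap_approx_rounded_weights) auto
  then show ?thesis
    unfolding F(1) by (rule vc_cap_approx_mono) (use \<beta>(2) fin weights in force)+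
qed

end

end

lemma rooted_graph_some_root:
  assumes "simple_graph V E" "connected_graph V E"
  shows "rooted_graph V E (SOME r. r \<in> V)"
  using assms some_in_eq[of V]
  by (simp add: rooted_graph_def simple_graph_def connected_graph_iff_reach)

theorem theorem4p2:
  "\<exists>(A :: 'v set \<Rightarrow> 'v set set \<Rightarrow> real \<Rightarrow> real \<Rightarrow>
          ('v link \<times> real, 'v link set) streaming_algorithm) (C :: real) (c :: nat).
     \<forall>V E W \<epsilon>. simple_graph V E \<longrightarrow> connected_graph V E \<longrightarrow> W \<ge> 1 \<longrightarrow> \<epsilon> > 0 \<longrightarrow>
       (\<forall>L w xs. L \<subseteq> V \<times> V \<longrightarrow> (\<forall>e\<in>L. 1 \<le> w e \<and> w e \<le> W) \<longrightarrow> arrival_order L xs \<longrightarrow>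
          runs_in_space (A V E W \<epsilon>) (word_bits c (card V)) (C * space_bound (card V) W \<epsilon>)
            (weighted_stream w xs) \<and>
          (vc_cap_solutions V E L \<noteq> {} \<longrightarrow>
             vc_cap_approx (3 + \<epsilon>) V E L w
               (stream_result (A V E W \<epsilon>) (weighted_stream w xs))))"
proof (intro exI[of _ "\<lambda>V E. rooted_graph.vc_cap_algorithm V E (SOME r. r \<in> V)"]
    exI[of _ "14 :: real"] exI[of _ "2 :: nat"] allI impI)
  fix V :: "'v set" and E and W \<epsilon> :: real and L w and xs :: "'v link list"
  assume "simple_graph V E" "connected_graph V E" and W: "1 \<le> W" and \<epsilon>: "0 < \<epsilon>"
    and stream: "L \<subseteq> V \<times> V" "\<forall>e\<in>L. 1 \<le> w e \<and> w e \<le> W" "arrival_order L xs"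
  then interpret rooted_graph V E "SOME r. r \<in> V" by (intro rooted_graph_some_root)
  show "runs_in_space (vc_cap_algorithm W \<epsilon>) (word_bits 2 (card V)) (14 * space_bound (card V) W \<epsilon>)
        (weighted_stream w xs) \<and>
      (vc_cap_solutions V E L \<noteq> {} \<longrightarrow>
        vc_cap_approx (3 + \<epsilon>) V E L w
          (stream_result (vc_cap_algorithm W \<epsilon>) (weighted_stream w xs)))"
    using vc_cap_algorithm_runs_in_space[OF \<epsilon> stream W] vc_cap_algorithm_approx[OF \<epsilon> stream]
    by blast
qed

end
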